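(* Let $B\ge 2$. For $\operatorname{Re}(s)>2$, $$ \sum_{n=1}^{\infty}\frac{c_B(\{1\}^n)}{n^s}= \frac{1}{B}\zeta(s-1)-\frac{1}{B^{s+1}}\sum_{k=1}^{B-1} k\, \zeta(s,k/B).$$
   Context: $c_B(\{1\}^n)$ denotes the base-$B$ carry sum $c_B(1,1,\dots,1)$ ($n$ copies of $1$): the sum of all carried numbers produced when computing $1+1+\dots+1$ by the traditional base-$B$ column addition algorithm (adding all $n$ summands column by column, where each column's total, including the incoming carry, contributes its residue mod $B$ as a digit and its quotient by $B$ as the carry). $\zeta(s)=\sum_{n\ge1}n^{-s}$ is the Riemann zeta function and $\zeta(s,x)=\sum_{n=0}^{\infty}(n+x)^{-s}$ for $x\in(0,1]$ is the Hurwitz zeta function.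
   Formalization: Carries are counted only out of columns occupied by digits of the summands, so c_B({1}^n)=floor(n/B); if the leading carry is itself processed through further columns, c_B({1}^n)=sum_j floor(n/B^j) and the stated identity fails (B=2, n=4 gives 3 instead of 2). *)

theory Defs
  imports "HOL-Analysis.Analysis"
begin

definition digit :: "nat \<Rightarrow> nat \<Rightarrow> nat \<Rightarrow> nat" where
  "digit B j a = (a div B ^ j) mod B"

definition num_columns :: "nat \<Rightarrow> nat list \<Rightarrow> nat" where
  "num_columns B as = (LEAST L. \<forall>a\<in>set as. a < B ^ L)"

text \<open>
  \<open>carry B as j\<close> is the number carried into column \<open>j\<close>; column 0 is the units column.
\<close>

fun carry :: "nat \<Rightarrow> nat list \<Rightarrow> nat \<Rightarrow> nat"
  and column_total :: "nat \<Rightarrow> nat list \<Rightarrow> nat \<Rightarrow> nat" where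
  "carry B as 0 = 0"
| "carry B as (Suc j) = column_total B as j div B"
| "column_total B as j = carry B as j + (\<Sum>a\<leftarrow>as. digit B j a)"

text \<open>
  The columns of an addition are those occupied by digits of the summands. The carry out of the
  leftmost column counts as a carried number; its base-\<open>B\<close> numeral is then written in front of the
  digits already obtained, and no further carries arise, even if it is at least \<open>B\<close>. Hence
  the carry sum of \<open>n\<close> copies of 1 is the single carry \<open>n div B\<close>. If the carry were instead
  propagated through the empty columns to the left, it would be the sum of \<open>n div B ^ j\<close> over
  \<open>j \<ge> 1\<close>. The two conventions agree for at most \<open>B\<close> summands.
\<close>

definition carry_sum :: "nat \<Rightarrow> nat list \<Rightarrow> nat" where
  "carry_sum B as = (\<Sum>j=1..num_columns B as. carry B as j)"

text \<open>
  The two series below represent the zeta functions only where they converge, that is, for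
  \<open>Re s > 1\<close>; no analytic continuation is involved.
\<close>

definition riemann_zeta :: "complex \<Rightarrow> complex" where
  "riemann_zeta s = (\<Sum>n. of_nat (Suc n) powr (- s))"

definition hurwitz_zeta :: "complex \<Rightarrow> real \<Rightarrow> complex" where
  "hurwitz_zeta s x = (\<Sum>n. of_real (real n + x) powr (- s))"

lemma sum_digits_eq_mod:
  "(\<Sum>j<L. digit B j a * B ^ j) = a mod B ^ L"
proof (induction L)
  case (Suc L)
  have "a mod B ^ Suc L = B ^ L * (a div B ^ L mod B) + a mod B ^ L"
    using mod_mult2_eq[of a "B ^ L" B] by (simp add: mult.commute)
  with Suc show ?case by (simp add: digit_def mult.commute)
qed simp

lemma column_addition_mod:
  "(\<Sum>j<L. (column_total B as j mod B) * B ^ j) + carry B as L * B ^ L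
     = (\<Sum>a\<leftarrow>as. a mod B ^ L)"
proof (induction L)
  case (Suc L)
  have *: "(\<Sum>a\<leftarrow>as. a mod B ^ Suc L) = (\<Sum>a\<leftarrow>as. a mod B ^ L) + (\<Sum>a\<leftarrow>as. digit B L a) * B ^ L"
    unfolding sum_digits_eq_mod[symmetric]
    by (simp add: sum_list_addf sum_list_mult_const)
  have "column_total B as L * B ^ L
      = (column_total B as L mod B) * B ^ L + (column_total B as L div B) * B ^ Suc L"
    by (metis add.commute add_mult_distrib mod_div_mult_eq mult.assoc power_Suc)
  with Suc * show ?case by (simp add: algebra_simps)
qed simp

lemma column_addition_correct:
  fixes as :: "nat list"
  assumes "B \<ge> 2"
  defines "L \<equiv> num_columns B as"
  shows "sum_list as = (\<Sum>j<L. (column_total B as j mod B) * B ^ j) + carry B as L * B ^ L"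
proof -
  have "\<forall>a\<in>set as. a < B ^ sum_list as"
  proof
    fix a assume "a \<in> set as"
    then have "a \<le> sum_list as" by (simp add: member_le_sum_list)
    also have "\<dots> < 2 ^ sum_list as" by simp
    also have "\<dots> \<le> B ^ sum_list as" using assms(1) by (simp add: power_mono)
    finally show "a < B ^ sum_list as" .
  qed
  then have "\<forall>a\<in>set as. a < B ^ L" unfolding L_def num_columns_def by (rule LeastI)
  then have "(\<Sum>a\<leftarrow>as. a mod B ^ L) = sum_list as" by (simp cong: map_cong)
  then show ?thesis using column_addition_mod[where L = L and B = B and as = as] by simp
qed

end

theory Submission
  imports Defs
begin

text \<open>
  Since \<open>n div B = (n - n mod B) / B\<close>, the Dirichlet series splits into \<open>\<zeta>(s - 1) / B\<close> minus
  the series of \<open>n mod B / n powr s\<close>, which is divided by \<open>B\<close> and regrouped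
  into blocks of length \<open>B\<close>: the residue class of \<open>k\<close> contributes \<open>k * B powr (- s)\<close> times a
  Hurwitz series at \<open>k / B\<close>.
\<close>

text \<open>The summand 1 lies below \<open>B ^ 1\<close> but not below \<open>B ^ 0 = 1\<close>, so
  one column is exactly what it occupies.\<close>

lemma num_columns_replicate_one:
  assumes "B \<ge> 2" "n > 0"
  shows "num_columns B (replicate n 1) = 1"
  unfolding num_columns_def
proof (rule Least_equality)
  fix L assume "\<forall>a\<in>set (replicate n (1::nat)). a < B ^ L"
  with \<open>n > 0\<close> have "1 < B ^ L" by auto
  then show "1 \<le> L" by (cases L) auto
qed (use assms in auto)

text \<open>The units column is the only one and totals \<open>n\<close>, so the only carry counted
  is the quotient leaving it.\<close>

lemma carry_sum_replicate_one:
  assumes "B \<ge> 2" "n > 0"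
  shows "carry_sum B (replicate n 1) = n div B"
  using assms num_columns_replicate_one[OF assms]
  by (simp add: carry_sum_def digit_def sum_list_replicate)

lemma norm_of_real_powr:
  fixes s :: complex
  assumes "x \<ge> 0"
  shows "norm (of_real x powr s) = x powr Re s"
  using assms by (subst norm_powr_real_powr) auto

lemma summable_of_nat_powr:
  fixes s :: complex
  assumes "Re s < -1"
  shows "summable (\<lambda>n. of_nat n powr s)"
proof (rule summable_norm_cancel)
  have "summable (\<lambda>n. real n powr Re s)"
    using assms by (simp add: summable_real_powr_iff)
  then show "summable (\<lambda>n. norm (of_nat n powr s))"
    using norm_of_real_powr[of "real n" s for n] by simp
qed

text \<open>As \<open>0 powr (- s) = 0\<close>, the series may start at \<open>n = 0\<close>; this
  indexing fits blocks that begin at multiples of \<open>B\<close>.\<close>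

lemma riemann_zeta_sums:
  assumes "Re s > 1"
  shows "(\<lambda>n. of_nat n powr (- s)) sums riemann_zeta s"
proof -
  have "summable (\<lambda>n. of_nat n powr (- s) :: complex)"
    using assms by (intro summable_of_nat_powr) auto
  then have "summable (\<lambda>n. of_nat (Suc n) powr (- s) :: complex)"
    by (subst summable_Suc_iff)
  then have "(\<lambda>n. of_nat (Suc n) powr (- s)) sums riemann_zeta s"
    unfolding riemann_zeta_def by (rule summable_sums)
  then show ?thesis by (subst (asm) sums_Suc_iff) simp
qed

lemma hurwitz_zeta_sums:
  assumes "Re s > 1" "x > 0"
  shows "(\<lambda>n. of_real (real n + x) powr (- s)) sums hurwitz_zeta s x"
  unfolding hurwitz_zeta_def
proof (rule summable_sums, rule summable_comparison_test)
  show "summable (\<lambda>n. real n powr (- Re s))"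
    using assms by (simp add: summable_real_powr_iff)
  \<comment> \<open>The index 0 is excluded: there the right side is
    \<open>0 powr (- Re s) = 0\<close>, while the left side is positive.\<close>
  have "norm (of_real (real n + x) powr (- s)) \<le> real n powr (- Re s)" if "n \<ge> 1" for n
  proof -
    have "norm (of_real (real n + x) powr (- s)) = (real n + x) powr (- Re s)"
      using assms by (subst norm_of_real_powr) auto
    also have "\<dots> \<le> real n powr (- Re s)"
      using assms that by (intro powr_mono2') auto
    finally show ?thesis .
  qed
  then show "\<exists>N. \<forall>n\<ge>N. norm (of_real (real n + x) powr (- s)) \<le> real n powr (- Re s)"
    by blast
qed

text \<open>Factor \<open>k + q * B = B * (q + k / B)\<close>. A complex power splits over this
  product because both factors are nonnegative reals.\<close>

lemma of_nat_add_mult_powr: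
  fixes s :: complex
  assumes "B > 0"
  shows "of_nat (k + q * B) powr s
    = of_nat B powr s * of_real (real q + real k / real B) powr s"
proof -
  have "of_nat (k + q * B) = of_real (real B) * (of_real (real q + real k / real B) :: complex)"
    using assms by (simp add: field_simps)
  also have "\<dots> powr s = of_real (real B) powr s * of_real (real q + real k / real B) powr s"
    by (rule powr_times_real) auto
  finally show ?thesis by simp
qed

lemma residue_dirichlet_series_sums:
  fixes s :: complex
  assumes "B > 0" "Re s > 1"
  shows "(\<lambda>n. of_nat (n mod B) * of_nat n powr (- s)) sums
    (of_nat B powr (- s) * (\<Sum>k=1..B-1. of_nat k * hurwitz_zeta s (real k / real B)))"
    (is "?f sums ?S")
proof -
  have "summable ?f"
  proof (rule summable_comparison_test)
    show "summable (\<lambda>n. real B * real n powr (- Re s))"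
      using assms by (intro summable_mult) (simp add: summable_real_powr_iff)
    have "norm (?f n) \<le> real B * real n powr (- Re s)" for n
      using assms norm_of_real_powr[of "real n" "- s"] less_imp_le[OF mod_less_divisor[of B n]]
      by (auto simp: norm_mult intro!: mult_right_mono)
    then show "\<exists>N. \<forall>n\<ge>N. norm (?f n) \<le> real B * real n powr (- Re s)" by blast
  qed
  \<comment> \<open>Convergence comes first, since \<open>sums_group\<close> only passes from a
    convergent series to its blocks. The value is identified afterwards.\<close>
  then have f: "?f sums suminf ?f" by (rule summable_sums)
  have "(\<Sum>n\<in>{q * B..<q * B + B}. ?f n)
      = (\<Sum>k=1..B-1. of_nat B powr (- s) * (of_nat k * of_real (real q + real k / real B) powr (- s)))"
    for q
  proof -
    have "(\<Sum>n\<in>{q * B..<q * B + B}. ?f n) = (\<Sum>k\<in>{0..<B}. ?f (k + q * B))"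
      using sum.shift_bounds_nat_ivl[of ?f 0 "q * B" B] by (simp add: add.commute)
    \<comment> \<open>The residue 0 has weight 0. Dropping it leaves only arguments
      \<open>k / B > 0\<close>, as \<open>hurwitz_zeta_sums\<close> requires.\<close>
    also have "\<dots> = (\<Sum>k\<in>{1..B-1}. ?f (k + q * B))"
      by (rule sum.mono_neutral_right) (auto simp: not_le Suc_le_eq)
    also have "\<dots> = (\<Sum>k=1..B-1. of_nat B powr (- s)
        * (of_nat k * of_real (real q + real k / real B) powr (- s)))"
    proof (rule sum.cong)
      fix k assume "k \<in> {1..B-1}"
      then have "(k + q * B) mod B = k" using assms by auto
      then show "?f (k + q * B)
          = of_nat B powr (- s) * (of_nat k * of_real (real q + real k / real B) powr (- s))"
        unfolding of_nat_add_mult_powr[OF \<open>B > 0\<close>] by simp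
    qed simp
    finally show ?thesis .
  qed
  with sums_group[OF f \<open>B > 0\<close>]
  have "(\<lambda>q. \<Sum>k=1..B-1. of_nat B powr (- s)
      * (of_nat k * of_real (real q + real k / real B) powr (- s))) sums suminf ?f"
    by simp
  \<comment> \<open>The sum over \<open>k\<close> is finite, so it may be exchanged with the series
    in \<open>q\<close>, which is a Hurwitz series for each \<open>k\<close>.\<close>
  moreover have "(\<lambda>q. \<Sum>k=1..B-1. of_nat B powr (- s)
      * (of_nat k * of_real (real q + real k / real B) powr (- s))) sums ?S"
    unfolding sum_distrib_left
    using assms by (intro sums_sum sums_mult hurwitz_zeta_sums) auto
  ultimately have "suminf ?f = ?S" by (rule sums_unique2)
  with f show ?thesis by simp
qed

theorem theorem3p2:
  fixes B :: nat and s :: complex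
  assumes "B \<ge> 2" and "Re s > 2"
  shows "(\<lambda>m. of_nat (carry_sum B (replicate (Suc m) 1)) / of_nat (Suc m) powr s) sums
    (1 / of_nat B * riemann_zeta (s - 1)
      - 1 / of_nat B powr (s + 1) * (\<Sum>k=1..B-1. of_nat k * hurwitz_zeta s (real k / real B)))"
proof -
  let ?H = "\<Sum>k=1..B-1. of_nat k * hurwitz_zeta s (real k / real B)"
  have "B > 0" using assms by simp
  \<comment> \<open>This is \<open>n - n mod B = B * (n div B)\<close> divided by \<open>B\<close>
    and by the \<open>s\<close>-th power of \<open>n\<close>. At \<open>n = 0\<close> both sides are
    0, by the conventions for \<open>0 powr\<close> and division by 0.\<close>
  have term_eq: "1 / of_nat B * of_nat n powr (- (s - 1))
        - 1 / of_nat B * (of_nat (n mod B) * of_nat n powr (- s))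
      = of_nat (n div B) / of_nat n powr s" for n
  proof (cases "n = 0")
    case False
    have "of_nat n powr (- (s - 1)) = of_nat n * (of_nat n powr (- s) :: complex)"
      using False powr_add[of "of_nat n :: complex" 1 "- s"] by simp
    moreover have "of_nat n = of_nat B * of_nat (n div B) + (of_nat (n mod B) :: complex)"
      by (metis mult_div_mod_eq of_nat_add of_nat_mult)
    ultimately show ?thesis
      using \<open>B > 0\<close> by (simp add: powr_minus divide_simps)
  qed simp
  \<comment> \<open>The assumption \<open>Re s > 2\<close> enters here: it gives
    \<open>Re (s - 1) > 1\<close>, so the two series converge separately.\<close>
  have "(\<lambda>n. 1 / of_nat B * of_nat n powr (- (s - 1))
        - 1 / of_nat B * (of_nat (n mod B) * of_nat n powr (- s))) sums
      (1 / of_nat B * riemann_zeta (s - 1) - 1 / of_nat B * (of_nat B powr (- s) * ?H))"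
    using assms
    by (intro sums_diff sums_mult riemann_zeta_sums residue_dirichlet_series_sums) auto
  moreover have "1 / of_nat B * (of_nat B powr (- s) * ?H) = 1 / of_nat B powr (s + 1) * ?H"
    using \<open>B > 0\<close> by (simp add: powr_add powr_minus divide_simps)
  ultimately have "(\<lambda>n. of_nat (n div B) / of_nat n powr s) sums
      (1 / of_nat B * riemann_zeta (s - 1) - 1 / of_nat B powr (s + 1) * ?H)"
    by (simp only: term_eq)
  \<comment> \<open>The term at \<open>n = 0\<close> vanishes, so shifting the index does not change
    the sum.\<close>
  then have "(\<lambda>m. of_nat (Suc m div B) / of_nat (Suc m) powr s) sums
      (1 / of_nat B * riemann_zeta (s - 1) - 1 / of_nat B powr (s + 1) * ?H)"
    by (subst sums_Suc_iff) simp
  then show ?thesis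
    by (simp only: carry_sum_replicate_one[OF \<open>B \<ge> 2\<close> zero_less_Suc])
qed

end
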